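(* Let $\psi_{\sigma,s,\omega_s}$ be a cluster symmetric map and let $F(\mathbf x)\in\mathbb Q[\mathbf x^{\pm}]$ be a Laurent polynomial of type $\frac{\bm\eta}{\mathbf d}$, written for each $k\in[1,n]$ as $F(\mathbf x)=\mathbf x^{-\mathbf d}\sum_{i=0}^{\eta_k}f_{k,i}(\mathbf x)x_k^i$ with $f_{k,i}\in\mathbb Q[\mathbf x]$ not involving $x_k$. Then $$F(\psi_{\sigma,s,\omega_s}(\mathbf x))=F(\mathbf x)$$ holds if and only if the following three relations hold: $$f_{\sigma^{-1}(s),i}(\sigma(\mathbf x))=f_{s,\eta_s-i}(\mathbf x)\,P_{\omega_s}(\mathbf x)^{d_s-i}\quad\text{for all } i\in[0,\eta_s],$$ $$\mathbf d=\sigma(\mathbf d),\qquad \eta_s=\eta_{\sigma^{-1}(s)}=2d_s=2d_{\sigma^{-1}(s)}.$$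
   Context: Fix $n\ge1$ and indeterminates $\mathbf x=(x_1,\dots,x_n)$; $[a,b]$ is the set of integers from $a$ to $b$; $\mathbf x^{\mathbf v}=\prod x_i^{v_i}$; for $\sigma\in\mathfrak S_n$, $\sigma(\mathbf v)=(v_{\sigma(1)},\dots,v_{\sigma(n)})$; $[a]_+=\max\{a,0\}$ componentwise. A seedlet at direction $s\in[1,n]$ is $\omega_s=(\mathbf b,r,Z)$ with $\mathbf b\in\mathbb Z^n$, $b_s=0$, $r\in\mathbb Z_{>0}$, and $Z(u)=\sum_{i=0}^r z_iu^i\in\mathbb Z_{\ge0}[u]$ with $z_0,z_r>0$. Its exchange polynomial is $P_{\omega_s}(\mathbf x)=\sum_{i=0}^r z_i\mathbf x^{i[\mathbf b]_++(r-i)[-\mathbf b]_+}$. For $\sigma\in\mathfrak S_n$ and $t=\sigma^{-1}(s)$, the cluster symmetric map $\psi_{\sigma,s,\omega_s}(\mathbf x)$ is the $n$-tuple whose $i$-th component is $x_{\sigma(i)}$ for $i\ne t$ and whose $t$-th component is $P_{\omega_s}(\mathbf x)/x_s$. $F$ is of type $\frac{\bm\eta}{\mathbf d}$ if $F=T(\mathbf x)/\mathbf x^{\mathbf d}$ with $T\in\mathbb Q[\mathbf x]$, $\mathbf d\in\mathbb Z^n$, $x_i\nmid T$ for all $i$, and $\eta_i$ is the degree of $T$ in $x_i$. Thus $f_{k,i}$ is the coefficient of $x_k^i$ in $T$. Identities with negative powers of $P_{\omega_s}$ are in the field $\mathbb Q(\mathbf x)$. *)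

theory Defs
  imports
    "HOL-Library.Poly_Mapping"
    "HOL-Computational_Algebra.Polynomial_Factorial"
begin

text \<open>
  The indeterminates are indexed by a finite type \<open>'n\<close>, which plays the role of \<open>[1, n]\<close>.
  Its linear order is only used to obtain the \<open>idom\<close> instance of the polynomial ring, hence
  its field of fractions.  Polynomials and Laurent polynomials are the monoid algebras of
  the exponent monoids \<open>'n \<Rightarrow>\<^sub>0 nat\<close> and \<open>'n \<Rightarrow>\<^sub>0 int\<close> over the rationals.
\<close>

type_synonym 'n mpoly = "('n \<Rightarrow>\<^sub>0 nat) \<Rightarrow>\<^sub>0 rat"
type_synonym 'n laurent = "('n \<Rightarrow>\<^sub>0 int) \<Rightarrow>\<^sub>0 rat"
type_synonym 'n ratfun = "'n mpoly fract"

definition var :: "'n \<Rightarrow> 'n mpoly" where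
  "var i = Poly_Mapping.single (Poly_Mapping.single i 1) 1"

definition vars :: "'n mpoly \<Rightarrow> 'n set" where
  "vars p = (\<Union>m\<in>Poly_Mapping.keys p. Poly_Mapping.keys m)"

definition degree_in :: "'n \<Rightarrow> 'n mpoly \<Rightarrow> nat" where
  "degree_in i p = Max (insert 0 ((\<lambda>m. Poly_Mapping.lookup m i) ` Poly_Mapping.keys p))"

definition rat_const :: "rat \<Rightarrow> 'n::{finite,linorder} ratfun" where
  "rat_const c = to_fract (Poly_Mapping.single 0 c)"

definition rat_var :: "'n \<Rightarrow> 'n::{finite,linorder} ratfun" where
  "rat_var i = to_fract (var i)"

definition rat_monom :: "('n \<Rightarrow> int) \<Rightarrow> 'n::{finite,linorder} ratfun" where
  "rat_monom v = (\<Prod>i\<in>UNIV. rat_var i powi v i)"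

definition poly_subst :: "'n mpoly \<Rightarrow> ('n \<Rightarrow> 'n ratfun) \<Rightarrow> 'n::{finite,linorder} ratfun" where
  "poly_subst p y = (\<Sum>m\<in>Poly_Mapping.keys p.
     rat_const (Poly_Mapping.lookup p m) * (\<Prod>i\<in>UNIV. y i ^ Poly_Mapping.lookup m i))"

text \<open>Substitution into a Laurent polynomial is only meaningful for tuples of nonzero rational
  functions; the components of a cluster symmetric map are nonzero.\<close>

definition laurent_subst :: "'n laurent \<Rightarrow> ('n \<Rightarrow> 'n ratfun) \<Rightarrow> 'n::{finite,linorder} ratfun" where
  "laurent_subst F y = (\<Sum>m\<in>Poly_Mapping.keys F.
     rat_const (Poly_Mapping.lookup F m) * (\<Prod>i\<in>UNIV. y i powi Poly_Mapping.lookup m i))"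

text \<open>A seedlet \<open>(b, r, Z)\<close>; taking \<open>Z\<close> over \<open>nat\<close> says that its coefficients are
  nonnegative integers.\<close>

record 'n seedlet =
  sl_vec :: "'n \<Rightarrow> int"
  sl_deg :: nat
  sl_poly :: "nat poly"

definition seedlet_at :: "'n \<Rightarrow> 'n seedlet \<Rightarrow> bool" where
  "seedlet_at s \<omega> \<longleftrightarrow> sl_vec \<omega> s = 0 \<and> sl_deg \<omega> > 0 \<and> degree (sl_poly \<omega>) = sl_deg \<omega> \<and>
     coeff (sl_poly \<omega>) 0 > 0 \<and> coeff (sl_poly \<omega>) (sl_deg \<omega>) > 0"

text \<open>Since \<open>nat\<close> truncates at zero, \<open>nat (b j)\<close> and \<open>nat (- b j)\<close> are the components of
  \<open>[b]\<^sub>+\<close> and \<open>[-b]\<^sub>+\<close>.\<close>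

definition exchange_poly :: "'n seedlet \<Rightarrow> 'n::{finite,linorder} mpoly" where
  "exchange_poly \<omega> = (\<Sum>i=0..sl_deg \<omega>. of_nat (coeff (sl_poly \<omega>) i) *
     (\<Prod>j\<in>UNIV. var j ^ (i * nat (sl_vec \<omega> j) + (sl_deg \<omega> - i) * nat (- sl_vec \<omega> j))))"

definition cluster_map ::
    "('n \<Rightarrow> 'n) \<Rightarrow> 'n \<Rightarrow> 'n seedlet \<Rightarrow> 'n \<Rightarrow> 'n::{finite,linorder} ratfun" where
  "cluster_map \<sigma> s \<omega> i =
     (if i = inv \<sigma> s then to_fract (exchange_poly \<omega>) / rat_var s else rat_var (\<sigma> i))"

definition laurent_type ::
    "'n::{finite,linorder} laurent \<Rightarrow> ('n \<Rightarrow> nat) \<Rightarrow> ('n \<Rightarrow> int) \<Rightarrow> bool" where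
  "laurent_type F \<eta> d \<longleftrightarrow> (\<exists>T :: 'n mpoly.
     laurent_subst F rat_var = to_fract T / rat_monom d \<and>
     (\<forall>i. \<not> var i dvd T) \<and> (\<forall>i. \<eta> i = degree_in i T))"

end

theory Submission
  imports Defs
begin

text \<open>
  Put \<open>t = \<sigma>\<^sup>-\<^sup>1(s)\<close>.  Up to monomials in the variables other than \<open>x\<^sub>s\<close>, the function
  \<open>F(\<psi>(x))\<close> is the sum of the terms \<open>f\<^sub>t\<^sub>,\<^sub>i(\<sigma>(x)) P\<^bsup>i-d\<^sub>t\<^esup> x\<^sub>s\<^bsup>d\<^sub>t-i\<^esup>\<close>, while \<open>F(x)\<close> is the sum of the terms
  \<open>f\<^sub>s\<^sub>,\<^sub>i x\<^sub>s\<^bsup>i-d\<^sub>s\<^esup>\<close>.  Only the powers of \<open>x\<^sub>s\<close> that are shown contain \<open>x\<^sub>s\<close>, so coefficients may be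
  compared.  The extreme coefficients are nonzero, which gives \<open>\<eta>\<^sub>s = \<eta>\<^sub>t = d\<^sub>s + d\<^sub>t\<close> and
  matches index \<open>i\<close> with \<open>\<eta>\<^sub>s - i\<close>.  For \<open>j \<noteq> s\<close>, no \<open>x\<^sub>j\<close> divides \<open>P\<close> or all coefficients on
  one side, so the exponents of \<open>x\<^sub>j\<close> in the two monomials agree, that is \<open>d = \<sigma>(d)\<close> away from
  \<open>s\<close>.  Summing the entries of \<open>d\<close> yields \<open>d\<^sub>t = d\<^sub>s\<close>.
\<close>

section \<open>Evaluation homomorphisms\<close>

locale comm_ring_hom =
  fixes h :: "'a::comm_ring_1 \<Rightarrow> 'b::comm_ring_1"
  assumes hom_add: "h (x + y) = h x + h y"
    and hom_mult: "h (x * y) = h x * h y"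
    and hom_one: "h 1 = 1"
begin

lemma hom_zero: "h 0 = 0"
  using hom_add[of 0 0] by simp

lemma hom_sum: "h (sum g A) = (\<Sum>i\<in>A. h (g i))"
  by (induction A rule: infinite_finite_induct) (simp_all add: hom_zero hom_add)

lemma hom_prod: "h (prod g A) = (\<Prod>i\<in>A. h (g i))"
  by (induction A rule: infinite_finite_induct) (simp_all add: hom_one hom_mult)

lemma hom_power: "h (x ^ k) = h x ^ k"
  by (induction k) (simp_all add: hom_one hom_mult)

lemma hom_of_nat: "h (of_nat k) = of_nat k"
  by (induction k) (simp_all add: hom_zero hom_one hom_add)

end

text \<open>The scalar map \<open>h\<close> is a parameter because values are taken in the
  rationals, in \<open>'n mpoly\<close>, in \<open>'n mpoly poly\<close> and in
  \<open>'n ratfun\<close>; one proof of the homomorphism laws serves all four.\<close>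

definition mpoly_eval ::
    "(rat \<Rightarrow> 'r::comm_ring_1) \<Rightarrow> ('n::finite \<Rightarrow> 'r) \<Rightarrow> 'n mpoly \<Rightarrow> 'r" where
  "mpoly_eval h y p = (\<Sum>m\<in>Poly_Mapping.keys p.
     h (Poly_Mapping.lookup p m) * (\<Prod>i\<in>UNIV. y i ^ Poly_Mapping.lookup m i))"

lemma poly_mapping_sum_singles:
  fixes p :: "'a \<Rightarrow>\<^sub>0 'b::comm_monoid_add"
  shows "(\<Sum>m\<in>Poly_Mapping.keys p. Poly_Mapping.single m (Poly_Mapping.lookup p m)) = p"
  by (rule poly_mapping_eqI)
     (auto simp: lookup_sum lookup_single when_def in_keys_iff sum.delta[OF finite_keys])

lemma poly_mapping_add_induct [case_names zero single add]:
  fixes p :: "'a \<Rightarrow>\<^sub>0 'b::comm_monoid_add"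
  assumes "P 0" and "\<And>m c. P (Poly_Mapping.single m c)"
    and "\<And>p q. P p \<Longrightarrow> P q \<Longrightarrow> P (p + q)"
  shows "P p"
proof -
  have "P (\<Sum>m\<in>A. Poly_Mapping.single m (Poly_Mapping.lookup p m))" for A
    using assms by (induction A rule: infinite_finite_induct) auto
  from this[of "Poly_Mapping.keys p"] show ?thesis
    by (simp only: poly_mapping_sum_singles)
qed

lemma mpoly_eval_cong:
  assumes "\<And>i. i \<in> vars p \<Longrightarrow> y i = z i"
  shows "mpoly_eval h y p = mpoly_eval h z p"
proof -
  have "y i ^ Poly_Mapping.lookup m i = z i ^ Poly_Mapping.lookup m i"
    if "m \<in> Poly_Mapping.keys p" for m i
  proof (cases "Poly_Mapping.lookup m i = 0")
    case False
    then have "i \<in> vars p" using that by (auto simp: vars_def in_keys_iff)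
    then show ?thesis by (simp add: assms)
  qed simp
  then show ?thesis by (simp add: mpoly_eval_def)
qed

context comm_ring_hom
begin

lemma hom_mpoly_eval: "h (mpoly_eval g y p) = mpoly_eval (h \<circ> g) (h \<circ> y) p"
  by (simp add: mpoly_eval_def hom_sum hom_mult hom_prod hom_power)

end

locale scalar_hom = comm_ring_hom h for h :: "rat \<Rightarrow> 'r::comm_ring_1"
begin

lemma mpoly_eval_single:
  "mpoly_eval h y (Poly_Mapping.single m c) = h c * (\<Prod>i\<in>UNIV. y i ^ Poly_Mapping.lookup m i)"
  by (cases "c = 0") (simp_all add: mpoly_eval_def hom_zero)

lemma mpoly_eval_add: "mpoly_eval h y (p + q) = mpoly_eval h y p + mpoly_eval h y q"
  unfolding mpoly_eval_def
  by (rule setsum_keys_plus_distrib) (simp_all add: hom_zero hom_add algebra_simps)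

text \<open>Both sides are additive in \<open>p\<close> and in \<open>q\<close>, so single terms
  suffice, and there exponents add.\<close>

lemma mpoly_eval_mult: "mpoly_eval h y (p * q) = mpoly_eval h y p * mpoly_eval h y q"
proof (induction p rule: poly_mapping_add_induct)
  case zero
  then show ?case by (simp add: mpoly_eval_def)
next
  case (single m c)
  show ?case
  proof (induction q rule: poly_mapping_add_induct)
    case zero
    then show ?case by (simp add: mpoly_eval_def)
  next
    case (single m' c')
    then show ?case
      by (simp add: mult_single mpoly_eval_single hom_mult lookup_add power_add prod.distrib)
  qed (simp add: distrib_left mpoly_eval_add)
qed (simp add: distrib_right mpoly_eval_add)

lemma mpoly_eval_var: "mpoly_eval h y (var i) = y i"
proof -
  have "(\<Prod>j\<in>UNIV. y j ^ Poly_Mapping.lookup (Poly_Mapping.single i (1::nat)) j)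
      = (\<Prod>j\<in>UNIV. if i = j then y j else 1)"
    by (rule prod.cong) (auto simp: lookup_single when_def)
  then show ?thesis by (simp add: var_def mpoly_eval_single hom_one)
qed

lemma comm_ring_hom_mpoly_eval: "comm_ring_hom (mpoly_eval h y)"
proof
  have "mpoly_eval h y (Poly_Mapping.single 0 1) = 1"
    by (subst mpoly_eval_single) (simp add: hom_one)
  then show "mpoly_eval h y 1 = 1" by simp
qed (simp_all add: mpoly_eval_add mpoly_eval_mult)

end

interpretation id_hom: scalar_hom id
  by unfold_locales simp_all

interpretation const_hom: scalar_hom "Poly_Mapping.single 0 :: rat \<Rightarrow> 'n mpoly"
  by unfold_locales (simp_all add: single_add mult_single)

interpretation pCons_hom: comm_ring_hom "\<lambda>a::'a::comm_ring_1. [:a:]"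
  by unfold_locales (simp_all add: one_pCons)

interpretation poly_const_hom:
  scalar_hom "\<lambda>c. [:Poly_Mapping.single 0 c:] :: 'n mpoly poly"
  by unfold_locales (simp_all add: single_add mult_single one_pCons mult.commute)

interpretation fract_hom: comm_ring_hom "to_fract :: 'a::idom \<Rightarrow> 'a fract"
  by unfold_locales simp_all

interpretation rat_const_hom: scalar_hom "rat_const :: rat \<Rightarrow> 'n::{finite,linorder} ratfun"
  by unfold_locales
     (simp_all add: rat_const_def single_add flip: to_fract_mult, simp add: mult_single)

lemma poly_subst_eq_mpoly_eval: "poly_subst p y = mpoly_eval rat_const y p"
  by (simp add: poly_subst_def mpoly_eval_def)

interpretation poly_subst_hom:
  comm_ring_hom "\<lambda>p. poly_subst p (y :: 'n::{finite,linorder} \<Rightarrow> 'n ratfun)" for y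
  unfolding poly_subst_eq_mpoly_eval by (rule rat_const_hom.comm_ring_hom_mpoly_eval)

lemma poly_subst_var: "poly_subst (var i) y = y i"
  by (simp add: poly_subst_eq_mpoly_eval rat_const_hom.mpoly_eval_var)

text \<open>Lets \<open>f(\<sigma>(x))\<close> be treated as a polynomial, for which divisibility
  and occurring variables make sense.\<close>

lemma to_fract_mpoly_eval:
  "to_fract (mpoly_eval (Poly_Mapping.single 0) y p) = poly_subst p (\<lambda>i. to_fract (y i))"
  by (simp add: fract_hom.hom_mpoly_eval poly_subst_eq_mpoly_eval rat_const_def[abs_def] comp_def)

lemma var_power: "var i ^ k = Poly_Mapping.single (Poly_Mapping.single i k) 1"
  by (induction k) (simp_all add: var_def mult_single flip: single_add)

lemma var_neq_0 [simp]: "var i \<noteq> 0"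
  by (metis keys_single keys_zero insert_not_empty var_def zero_neq_one)

lemma prod_var_power_eq_single:
  fixes m :: "'n::finite \<Rightarrow>\<^sub>0 nat"
  shows "(\<Prod>i\<in>UNIV. var i ^ Poly_Mapping.lookup m i) = Poly_Mapping.single m 1"
proof -
  have *: "(\<Prod>i\<in>A. var i ^ Poly_Mapping.lookup m i) =
      Poly_Mapping.single (\<Sum>i\<in>A. Poly_Mapping.single i (Poly_Mapping.lookup m i)) 1" for A
    by (induction A rule: infinite_finite_induct) (simp_all add: var_power mult_single)
  have "(\<Sum>i\<in>UNIV. Poly_Mapping.single i (Poly_Mapping.lookup m i)) = m"
    by (rule poly_mapping_eqI) (simp add: lookup_sum lookup_single when_def)
  with * show ?thesis by simp
qed

lemma mpoly_eval_vars: "mpoly_eval (Poly_Mapping.single 0) var p = p"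
  by (simp add: mpoly_eval_def prod_var_power_eq_single mult_single poly_mapping_sum_singles)

section \<open>Variables and divisibility by a variable\<close>

lemma vars_mult: "vars (p * q) \<subseteq> vars p \<union> vars q"
proof
  fix i assume "i \<in> vars (p * q)"
  then obtain m where m: "m \<in> Poly_Mapping.keys (p * q)" "i \<in> Poly_Mapping.keys m"
    by (auto simp: vars_def)
  from m(1) keys_mult[of p q] obtain a b where
    "m = a + b" "a \<in> Poly_Mapping.keys p" "b \<in> Poly_Mapping.keys q" by auto
  with m(2) keys_add[of a b] show "i \<in> vars p \<union> vars q" by (auto simp: vars_def)
qed

lemma vars_sum: "vars (sum g A) \<subseteq> (\<Union>a\<in>A. vars (g a))"
  using keys_sum[of g A] by (fastforce simp: vars_def)

lemma vars_const [simp]: "vars (Poly_Mapping.single 0 c) = {}"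
  by (simp add: vars_def)

lemma vars_one [simp]: "vars 1 = {}"
  by (simp add: vars_def)

lemma vars_of_nat [simp]: "vars (of_nat k) = {}"
  by (metis single_of_nat vars_const)

lemma vars_var_power: "vars (var i ^ k) \<subseteq> (if k = 0 then {} else {i})"
  by (auto simp: vars_def var_power)

lemma vars_power: "vars (p ^ k) \<subseteq> vars p"
proof (induction k)
  case (Suc k)
  then show ?case using vars_mult[of p "p ^ k"] by auto
qed simp

lemma vars_prod: "vars (prod g A) \<subseteq> (\<Union>a\<in>A. vars (g a))"
proof (induction A rule: infinite_finite_induct)
  case (insert a A)
  then show ?case using vars_mult[of "g a" "prod g A"] by auto
qed simp_all

lemma vars_mpoly_eval:
  "vars (mpoly_eval (Poly_Mapping.single 0) y p) \<subseteq> (\<Union>i\<in>vars p. vars (y i))"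
proof
  fix j assume "j \<in> vars (mpoly_eval (Poly_Mapping.single 0) y p)"
  then obtain m where m: "m \<in> Poly_Mapping.keys p" and
    "j \<in> vars (Poly_Mapping.single 0 (Poly_Mapping.lookup p m) *
       (\<Prod>i\<in>UNIV. y i ^ Poly_Mapping.lookup m i))"
    unfolding mpoly_eval_def using vars_sum by fastforce
  then have "j \<in> vars (\<Prod>i\<in>UNIV. y i ^ Poly_Mapping.lookup m i)"
    using vars_mult by fastforce
  then obtain i where i: "j \<in> vars (y i ^ Poly_Mapping.lookup m i)"
    using vars_prod[of "\<lambda>i. y i ^ Poly_Mapping.lookup m i" UNIV] by blast
  then have "Poly_Mapping.lookup m i \<noteq> 0" by (metis empty_iff power_0 vars_one)
  with m have "i \<in> vars p" by (simp add: vars_def in_keys_iff bexI[of _ m])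
  moreover have "j \<in> vars (y i)" using i by (rule subsetD[OF vars_power])
  ultimately show "j \<in> (\<Union>i\<in>vars p. vars (y i))" by blast
qed

interpretation mpoly_subst_hom:
  comm_ring_hom "mpoly_eval (Poly_Mapping.single 0) y :: 'm::finite mpoly \<Rightarrow> 'n mpoly" for y
  by (rule const_hom.comm_ring_hom_mpoly_eval)

text \<open>By additivity a single term suffices: setting \<open>x\<^sub>j\<close> to zero fixes a
  term without \<open>x\<^sub>j\<close> and kills a term that contains it, which is then a multiple
  of \<open>x\<^sub>j\<close>.\<close>

lemma var_dvd_diff_eval_zero:
  "var j dvd p - mpoly_eval (Poly_Mapping.single 0) (var(j := 0)) p"
proof (induction p rule: poly_mapping_add_induct)
  case zero
  then show ?case by (simp add: mpoly_eval_def)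
next
  case (single m c)
  show ?case
  proof (cases "Poly_Mapping.lookup m j = 0")
    case True
    then have "(\<Prod>i\<in>UNIV. (var(j := 0)) i ^ Poly_Mapping.lookup m i) =
        (\<Prod>i\<in>UNIV. var i ^ Poly_Mapping.lookup m i)"
      by (intro prod.cong) auto
    also have "\<dots> = Poly_Mapping.single m 1" by (rule prod_var_power_eq_single)
    finally show ?thesis by (simp add: const_hom.mpoly_eval_single mult_single)
  next
    case False
    then have "(\<Prod>i\<in>UNIV. (var(j := 0)) i ^ Poly_Mapping.lookup m i) = (0 :: 'a mpoly)"
      by (intro prod_zero bexI[of _ j]) (simp_all add: zero_power)
    then have "mpoly_eval (Poly_Mapping.single 0) (var(j := 0)) (Poly_Mapping.single m c) = 0"
      by (simp only: const_hom.mpoly_eval_single mult_zero_right)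
    moreover have "m = Poly_Mapping.single j 1 + (m - Poly_Mapping.single j 1)"
      using False by (intro poly_mapping_eqI)
        (auto simp: lookup_add lookup_minus lookup_single when_def)
    then have "Poly_Mapping.single m c =
        var j * Poly_Mapping.single (m - Poly_Mapping.single j 1) c"
      by (simp add: var_def mult_single)
    ultimately show ?thesis
      by (metis diff_zero dvd_triv_left)
  qed
next
  case (add p q)
  from dvd_add[OF this] show ?case
    by (simp add: const_hom.mpoly_eval_add algebra_simps)
qed

text \<open>Divisibility by \<open>x\<^sub>j\<close> becomes membership in the kernel of a
  homomorphism. Over an integral domain this yields the primality of \<open>x\<^sub>j\<close> in
  \<open>var_dvd_mult_iff\<close>.\<close>

lemma var_dvd_iff: "var j dvd p \<longleftrightarrow> mpoly_eval (Poly_Mapping.single 0) (var(j := 0)) p = 0"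
proof
  assume "var j dvd p"
  then show "mpoly_eval (Poly_Mapping.single 0) (var(j := 0)) p = 0"
    by (auto simp: dvd_def const_hom.mpoly_eval_mult const_hom.mpoly_eval_var)
next
  assume "mpoly_eval (Poly_Mapping.single 0) (var(j := 0)) p = 0"
  then show "var j dvd p" using var_dvd_diff_eval_zero[of j p] by simp
qed

lemma var_dvd_mult_iff:
  fixes p q :: "'n::{finite,linorder} mpoly"
  shows "var j dvd p * q \<longleftrightarrow> var j dvd p \<or> var j dvd q"
  by (simp add: var_dvd_iff const_hom.mpoly_eval_mult)

lemma var_dvd_power_iff:
  fixes p :: "'n::{finite,linorder} mpoly"
  shows "var j dvd p ^ k \<longleftrightarrow> k \<noteq> 0 \<and> var j dvd p"
  by (auto simp: var_dvd_iff mpoly_subst_hom.hom_power)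

lemma var_dvd_var_iff:
  fixes j k :: "'n::finite"
  shows "var j dvd var k \<longleftrightarrow> j = k"
  by (simp add: var_dvd_iff const_hom.mpoly_eval_var)

lemma var_dvd_prod_iff:
  fixes g :: "'a \<Rightarrow> 'n::{finite,linorder} mpoly"
  assumes "finite A"
  shows "var j dvd prod g A \<longleftrightarrow> (\<exists>a\<in>A. var j dvd g a)"
  using assms by (simp add: var_dvd_iff mpoly_subst_hom.hom_prod)

text \<open>Renaming along \<open>inv \<sigma>\<close> is a homomorphism that undoes the renaming
  along \<open>\<sigma>\<close>, so it carries the divisibility back.\<close>

lemma var_dvd_if_var_dvd_rename:
  fixes \<sigma> :: "'m::finite \<Rightarrow> 'n::finite"
  assumes "bij \<sigma>" and "var (\<sigma> i) dvd mpoly_eval (Poly_Mapping.single 0) (\<lambda>j. var (\<sigma> j)) p"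
  shows "var i dvd p"
proof -
  let ?R = "mpoly_eval (Poly_Mapping.single 0) (\<lambda>j. var (\<sigma> j)) :: 'm mpoly \<Rightarrow> 'n mpoly"
  let ?R' = "mpoly_eval (Poly_Mapping.single 0) (\<lambda>j. var (inv \<sigma> j)) :: 'n mpoly \<Rightarrow> 'm mpoly"
  obtain q where "?R p = var (\<sigma> i) * q" using assms(2) by (auto simp: dvd_def)
  then have "?R' (?R p) = ?R' (var (\<sigma> i)) * ?R' q"
    by (simp add: const_hom.mpoly_eval_mult)
  moreover have "?R' (var (\<sigma> i)) = var i"
    using assms(1) by (simp add: const_hom.mpoly_eval_var bij_is_inj)
  moreover have "?R' (?R p) = p"
    using assms(1)
    by (simp add: mpoly_subst_hom.hom_mpoly_eval comp_def const_hom.mpoly_eval_var bij_is_inj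
        const_hom.mpoly_eval_single mpoly_eval_vars)
  ultimately show ?thesis by simp
qed

section \<open>Expansions in powers of one variable\<close>

text \<open>The variable \<open>x\<^sub>s\<close> becomes the indeterminate of a univariate polynomial whose
  coefficients are again multivariate polynomials.\<close>

definition expand_in :: "'n::finite \<Rightarrow> 'n mpoly \<Rightarrow> 'n mpoly poly" where
  "expand_in s = mpoly_eval (\<lambda>c. [:Poly_Mapping.single 0 c:])
     (\<lambda>j. if j = s then [:0, 1:] else [:var j:])"

interpretation expand_in_hom: comm_ring_hom "expand_in s" for s :: "'n::finite"
  unfolding expand_in_def by (rule poly_const_hom.comm_ring_hom_mpoly_eval)

lemma expand_in_var: "expand_in s (var s) = [:0, 1:]"
  by (simp add: expand_in_def poly_const_hom.mpoly_eval_var)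

lemma expand_in_of_notin_vars:
  assumes "s \<notin> vars p"
  shows "expand_in s p = [:p:]"
proof -
  have "expand_in s p = mpoly_eval (\<lambda>c. [:Poly_Mapping.single 0 c:]) (\<lambda>j. [:var j:]) p"
    unfolding expand_in_def using assms by (intro mpoly_eval_cong) auto
  also have "\<dots> = [:mpoly_eval (Poly_Mapping.single 0) var p:]"
    by (simp add: pCons_hom.hom_mpoly_eval comp_def)
  finally show ?thesis by (simp add: mpoly_eval_vars)
qed

text \<open>The \<open>a i\<close> become constants under \<open>expand_in\<close>. Injectivity of
  \<open>e\<close> is not assumed, so summands that share an exponent are collected.\<close>

lemma coeff_expand_in_sum:
  assumes "\<And>i. i \<in> I \<Longrightarrow> s \<notin> vars (a i)"
  shows "coeff (expand_in s (\<Sum>i\<in>I. a i * var s ^ e i)) k = (\<Sum>i\<in>I. if e i = k then a i else 0)"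
proof -
  have "expand_in s (\<Sum>i\<in>I. a i * var s ^ e i) = (\<Sum>i\<in>I. monom (a i) (e i))"
    unfolding expand_in_hom.hom_sum
  proof (rule sum.cong)
    fix i assume "i \<in> I"
    then show "expand_in s (a i * var s ^ e i) = monom (a i) (e i)"
      using assms by (simp add: expand_in_hom.hom_mult expand_in_hom.hom_power expand_in_var
          expand_in_of_notin_vars monom_altdef)
  qed simp
  then show ?thesis by (simp add: coeff_sum)
qed

text \<open>A monomial of \<open>T\<close> with maximal exponent of \<open>x\<^sub>k\<close> can
  only come from the last summand, because the coefficients contribute no
  \<open>x\<^sub>k\<close>.\<close>

lemma leading_coeff_nonzero:
  assumes T: "T = (\<Sum>i=0..degree_in k T. f i * var k ^ i)" "T \<noteq> 0"
    and f: "\<And>i. i \<le> degree_in k T \<Longrightarrow> k \<notin> vars (f i)"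
  shows "f (degree_in k T) \<noteq> 0"
proof -
  let ?D = "(\<lambda>m. Poly_Mapping.lookup m k) ` Poly_Mapping.keys T"
  \<comment> \<open>The default 0 in \<open>degree_in\<close> matters only for the zero polynomial;
    here the maximum is attained by a monomial of \<open>T\<close>.\<close>
  have "?D \<noteq> {}" using T(2) by simp
  then have "degree_in k T = Max ?D"
    unfolding degree_in_def by (subst Max_insert) auto
  moreover have "Max ?D \<in> ?D" using \<open>?D \<noteq> {}\<close> by (intro Max_in) simp_all
  ultimately obtain m where
    m: "m \<in> Poly_Mapping.keys T" "Poly_Mapping.lookup m k = degree_in k T" by (metis imageE)
  have "m \<in> Poly_Mapping.keys (\<Sum>i=0..degree_in k T. f i * var k ^ i)"
    using m(1) T(1) by simp
  then obtain i where i: "i \<le> degree_in k T" "m \<in> Poly_Mapping.keys (f i * var k ^ i)"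
    using keys_sum by fastforce
  then obtain a where a: "a \<in> Poly_Mapping.keys (f i)" "m = a + Poly_Mapping.single k i"
    using keys_mult[of "f i" "var k ^ i"] by (auto simp: var_power)
  have "Poly_Mapping.lookup a k = 0" using f[OF i(1)] a(1) by (auto simp: vars_def in_keys_iff)
  then have "i = degree_in k T" using a(2) m(2) by (simp add: lookup_add)
  then show ?thesis using a(1) by auto
qed

section \<open>The exchange polynomial\<close>

lemma exchange_poly_not_var_dvd:
  fixes \<omega> :: "'n::{finite,linorder} seedlet"
  assumes "seedlet_at s \<omega>"
  shows "\<not> var j dvd exchange_poly \<omega>"
proof
  let ?b = "sl_vec \<omega>" and ?r = "sl_deg \<omega>" and ?z = "coeff (sl_poly \<omega>)"
  \<comment> \<open>At this test point multiples of \<open>x\<^sub>j\<close> vanish, while each term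
    of the exchange polynomial contributes 0 or its coefficient.\<close>
  let ?y = "\<lambda>k. if k = j then 0 else 1 :: rat"
  let ?e = "\<lambda>i k. i * nat (?b k) + (?r - i) * nat (- ?b k)"
  interpret y: comm_ring_hom "mpoly_eval id ?y" by (rule id_hom.comm_ring_hom_mpoly_eval)
  assume "var j dvd exchange_poly \<omega>"
  then have "mpoly_eval id ?y (exchange_poly \<omega>) = 0"
    by (auto simp: dvd_def y.hom_mult id_hom.mpoly_eval_var)
  then have 0: "(\<Sum>i=0..?r. of_nat (?z i) * (\<Prod>k\<in>UNIV. ?y k ^ ?e i k)) = 0"
    by (simp add: exchange_poly_def y.hom_sum y.hom_mult y.hom_prod y.hom_power y.hom_of_nat
        id_hom.mpoly_eval_var)
  \<comment> \<open>One of the two extreme terms of the exchange polynomial is free of \<open>x\<^sub>j\<close>, and nonnegative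
    coefficients cannot cancel it.\<close>
  define i where "i = (if ?b j \<ge> 0 then 0 else ?r)"
  have i: "i \<le> ?r" "?z i > 0" "?e i j = 0"
    using assms by (auto simp: i_def seedlet_at_def)
  have "of_nat (?z i) * (\<Prod>k\<in>UNIV. ?y k ^ ?e i k) = 0"
    using 0 i(1) by (subst (asm) sum_nonneg_eq_0_iff) (auto intro!: mult_nonneg_nonneg prod_nonneg)
  moreover have "(\<Prod>k\<in>UNIV. ?y k ^ ?e i k) = 1"
    using i(3) by (intro prod.neutral) auto
  ultimately show False using i(2) by simp
qed

text \<open>The condition \<open>b\<^sub>s = 0\<close> makes the exponent of
  \<open>x\<^sub>s\<close> zero in every term.\<close>

lemma exchange_poly_notin_vars:
  assumes "seedlet_at s \<omega>"
  shows "s \<notin> vars (exchange_poly \<omega>)"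
proof
  let ?e = "\<lambda>i j. i * nat (sl_vec \<omega> j) + (sl_deg \<omega> - i) * nat (- sl_vec \<omega> j)"
  assume "s \<in> vars (exchange_poly \<omega>)"
  then obtain i where
    "s \<in> vars (of_nat (coeff (sl_poly \<omega>) i) * (\<Prod>j\<in>UNIV. var j ^ ?e i j))"
    unfolding exchange_poly_def using vars_sum by fastforce
  then have "s \<in> vars (\<Prod>j\<in>UNIV. var j ^ ?e i j)"
    using vars_mult by fastforce
  then obtain j where "s \<in> vars (var j ^ ?e i j)" using vars_prod by fastforce
  with vars_var_power[of j "?e i j"] have "?e i j \<noteq> 0" "s = j"
    by (auto split: if_splits)
  then show False using assms by (simp add: seedlet_at_def)
qed

section \<open>Substitution into Laurent polynomials\<close>

lemma poly_subst_const: "poly_subst (Poly_Mapping.single 0 c) y = rat_const c"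
  by (simp add: poly_subst_eq_mpoly_eval rat_const_hom.mpoly_eval_single)

lemma poly_subst_rat_var: "poly_subst p rat_var = to_fract p"
  using to_fract_mpoly_eval[of var p]
  by (simp add: mpoly_eval_vars rat_var_def[abs_def])

lemma rat_var_neq_0 [simp]: "rat_var i \<noteq> 0"
  by (simp add: rat_var_def)

text \<open>After multiplication by a large power of \<open>x\<^sub>1 \<cdots> x\<^sub>n\<close> the hypothesis becomes an
  identity of polynomials, in which any tuple may be substituted.\<close>

lemma laurent_subst_quotient:
  fixes F :: "'n::{finite,linorder} laurent"
  assumes F: "laurent_subst F rat_var = to_fract T / rat_monom d"
    and y: "\<And>i. y i \<noteq> 0"
  shows "laurent_subst F y = poly_subst T y / (\<Prod>i\<in>UNIV. y i powi d i)"
proof -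
  \<comment> \<open>\<open>N\<close> bounds all exponents involved, so no \<open>nat\<close> in
    \<open>G\<close> or \<open>D\<close> truncates.\<close>
  define N where "N = (\<Sum>i\<in>UNIV. \<bar>d i\<bar>) +
    (\<Sum>m\<in>Poly_Mapping.keys F. \<Sum>i\<in>UNIV. \<bar>Poly_Mapping.lookup m i\<bar>)"
  have dN: "d i \<le> N" for i
  proof -
    have "\<bar>d i\<bar> \<le> (\<Sum>i\<in>UNIV. \<bar>d i\<bar>)" by (rule member_le_sum) simp_all
    moreover have "0 \<le> (\<Sum>m\<in>Poly_Mapping.keys F. \<Sum>i\<in>UNIV. \<bar>Poly_Mapping.lookup m i\<bar>)"
      by (intro sum_nonneg) simp
    ultimately show ?thesis unfolding N_def by linarith
  qed
  have mN: "0 \<le> Poly_Mapping.lookup m i + N" if "m \<in> Poly_Mapping.keys F" for m i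
  proof -
    have "\<bar>Poly_Mapping.lookup m i\<bar> \<le> (\<Sum>i\<in>UNIV. \<bar>Poly_Mapping.lookup m i\<bar>)"
      by (rule member_le_sum) simp_all
    also have "\<dots> \<le> (\<Sum>m\<in>Poly_Mapping.keys F. \<Sum>i\<in>UNIV. \<bar>Poly_Mapping.lookup m i\<bar>)"
      using that by (intro member_le_sum[where f = "\<lambda>m. \<Sum>i\<in>UNIV. \<bar>Poly_Mapping.lookup m i\<bar>"])
        (auto intro: sum_nonneg)
    moreover have "0 \<le> (\<Sum>i\<in>UNIV. \<bar>d i\<bar>)" by (intro sum_nonneg) simp
    ultimately show ?thesis unfolding N_def by linarith
  qed
  \<comment> \<open>\<open>G\<close> is \<open>F\<close> times the \<open>N\<close>-th power of the
    product of all variables, and \<open>D\<close> is that power divided by the monomial of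
    \<open>d\<close>; the hypothesis turns into \<open>T * D = G\<close>.\<close>
  define G :: "'n mpoly" where "G = (\<Sum>m\<in>Poly_Mapping.keys F.
    Poly_Mapping.single 0 (Poly_Mapping.lookup F m) *
    (\<Prod>i\<in>UNIV. var i ^ nat (Poly_Mapping.lookup m i + N)))"
  define D :: "'n mpoly" where "D = (\<Prod>i\<in>UNIV. var i ^ nat (N - d i))"
  have G: "poly_subst G z = laurent_subst F z * (\<Prod>i\<in>UNIV. z i powi N)"
    if z: "\<And>i. z i \<noteq> 0" for z
    unfolding G_def poly_subst_hom.hom_sum laurent_subst_def sum_distrib_right
  proof (rule sum.cong)
    fix m assume m: "m \<in> Poly_Mapping.keys F"
    have "z i ^ nat (Poly_Mapping.lookup m i + N) = z i powi Poly_Mapping.lookup m i * z i powi N"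
      for i
      using mN[OF m, of i] z by (simp add: power_int_nonneg_exp flip: power_int_add)
    then show "poly_subst (Poly_Mapping.single 0 (Poly_Mapping.lookup F m) *
        (\<Prod>i\<in>UNIV. var i ^ nat (Poly_Mapping.lookup m i + N))) z =
      rat_const (Poly_Mapping.lookup F m) * (\<Prod>i\<in>UNIV. z i powi Poly_Mapping.lookup m i) *
      (\<Prod>i\<in>UNIV. z i powi N)"
      by (simp add: poly_subst_hom.hom_mult poly_subst_hom.hom_prod poly_subst_hom.hom_power
          poly_subst_const poly_subst_var prod.distrib)
  qed simp
  have D: "poly_subst D z = (\<Prod>i\<in>UNIV. z i powi N) / (\<Prod>i\<in>UNIV. z i powi d i)"
    if z: "\<And>i. z i \<noteq> 0" for z
  proof -
    have "z i ^ nat (N - d i) = z i powi N / z i powi d i" for i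
      using dN[of i] z by (simp add: power_int_nonneg_exp flip: power_int_diff)
    then show ?thesis
      by (simp add: D_def poly_subst_hom.hom_prod poly_subst_hom.hom_power poly_subst_var
          prod_dividef)
  qed
  have "to_fract (T * D) = to_fract G"
    using G[of rat_var] D[of rat_var] F
    by (simp add: poly_subst_rat_var rat_monom_def)
  then have "T * D = G" by (simp only: to_fract_eq_iff)
  then have "poly_subst T y * poly_subst D y = poly_subst G y"
    by (simp flip: poly_subst_hom.hom_mult)
  with y show ?thesis by (simp add: G D field_simps)
qed

section \<open>The exchange relations\<close>

text \<open>Cancelling the smaller power leaves a positive power of \<open>x\<^sub>j\<close> on the
  left.\<close>

lemma var_dvd_if_power_less:
  fixes u v :: "'n::{finite,linorder} mpoly"
  assumes "var j ^ k * u = var j ^ l * v" and "l < k"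
  shows "var j dvd v"
proof -
  have "var j ^ l * (var j ^ (k - l) * u) = var j ^ l * v"
    using assms by (simp flip: mult.assoc power_add)
  then have "var j ^ (k - l) * u = v" by simp
  moreover have "var j dvd var j ^ (k - l) * u"
    using assms(2) by (intro dvd_mult2 dvd_power) simp
  ultimately show ?thesis by simp
qed

lemma power_nat_eq_powi_mult:
  fixes x :: "'a::field"
  assumes "x \<noteq> 0" "n = a + b" "0 \<le> n"
  shows "x ^ nat n = x powi a * x powi b"
  using assms by (metis power_int_add power_int_nonneg_exp)

theorem theorem2p16:
  fixes \<sigma> :: "'n::{finite,linorder} \<Rightarrow> 'n" and s :: 'n and \<omega> :: "'n seedlet"
    and F :: "'n laurent" and \<eta> :: "'n \<Rightarrow> nat" and d :: "'n \<Rightarrow> int"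
    and f :: "'n \<Rightarrow> nat \<Rightarrow> 'n mpoly"
  assumes "bij \<sigma>"
    and "seedlet_at s \<omega>"
    and "laurent_type F \<eta> d"
    and "\<And>k. laurent_subst F rat_var =
           to_fract (\<Sum>i=0..\<eta> k. f k i * var k ^ i) / rat_monom d"
    and "\<And>k i. i \<le> \<eta> k \<Longrightarrow> k \<notin> vars (f k i)"
  shows "laurent_subst F (cluster_map \<sigma> s \<omega>) = laurent_subst F rat_var \<longleftrightarrow>
    (\<forall>i\<in>{0..\<eta> s}. poly_subst (f (inv \<sigma> s) i) (\<lambda>j. rat_var (\<sigma> j)) =
        to_fract (f s (\<eta> s - i)) * to_fract (exchange_poly \<omega>) powi (d s - int i)) \<and>
    (\<forall>i. d i = d (\<sigma> i)) \<and>
    \<eta> s = \<eta> (inv \<sigma> s) \<and> int (\<eta> (inv \<sigma> s)) = 2 * d s \<and> 2 * d s = 2 * d (inv \<sigma> s)"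
proof -

  \<comment> \<open>Notation and nonvanishing of the extreme coefficients\<close>
  define t where "t = inv \<sigma> s"
  define P where "P = exchange_poly \<omega>"
  define p where "p = to_fract P"
  define X where "X = rat_var s"
  define g where "g i = mpoly_eval (Poly_Mapping.single 0) (\<lambda>j. var (\<sigma> j)) (f t i)" for i
  define y where "y = cluster_map \<sigma> s \<omega>"
  \<comment> \<open>The variable \<open>x\<^sub>s\<close> is left out, so that all its powers stay
    visible in \<open>X\<close>.\<close>
  define Q where "Q \<delta> = (\<Prod>j\<in>-{s}. rat_var j powi \<delta> j)" for \<delta> :: "'n \<Rightarrow> int"
  have \<sigma>t: "\<sigma> t = s" and inv_\<sigma>: "\<And>i. inv \<sigma> (\<sigma> i) = i" and \<sigma>_inv: "\<And>i. \<sigma> (inv \<sigma> i) = i"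
    using assms(1) by (simp_all add: t_def bij_is_surj surj_f_inv_f bij_is_inj)
  have inv_eq_t: "inv \<sigma> j = t \<longleftrightarrow> j = s" for j
    by (metis \<sigma>_inv t_def)
  have \<sigma>_eq_s: "s = \<sigma> j \<longleftrightarrow> j = t" for j
    using inv_\<sigma> \<sigma>t by metis
  obtain T where T: "laurent_subst F rat_var = to_fract T / rat_monom d"
    and T_dvd: "\<And>i. \<not> var i dvd T" and \<eta>: "\<And>i. \<eta> i = degree_in i T"
    using assms(3) unfolding laurent_type_def by blast
  have "rat_monom d \<noteq> 0" by (simp add: rat_monom_def)
  have T_eq: "T = (\<Sum>i=0..\<eta> k. f k i * var k ^ i)" for k
  proof -
    have "to_fract T = to_fract (\<Sum>i=0..\<eta> k. f k i * var k ^ i)"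
      using T assms(4)[of k] \<open>rat_monom d \<noteq> 0\<close> by (simp only: divide_cancel_right simp_thms)
    then show ?thesis by (simp only: to_fract_eq_iff)
  qed
  have "T \<noteq> 0" using T_dvd[of s] by auto
  have f_last: "f k (\<eta> k) \<noteq> 0" for k
    unfolding \<eta>
    using T_eq[of k, unfolded \<eta>] \<open>T \<noteq> 0\<close> assms(5)[of _ k, unfolded \<eta>]
    by (rule leading_coeff_nonzero)
  \<comment> \<open>Otherwise every summand, and hence \<open>T\<close>, would be divisible by
    \<open>x\<^sub>k\<close>.\<close>
  have f_0: "f k 0 \<noteq> 0" for k
  proof
    assume "f k 0 = 0"
    have "var k dvd f k i * var k ^ i" for i
      by (cases i) (simp_all add: \<open>f k 0 = 0\<close>)
    then have "var k dvd T" by (subst T_eq[of k]) (intro dvd_sum)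
    with T_dvd show False by blast
  qed
  have P_dvd: "\<not> var j dvd P" for j
    using assms(2) by (simp add: P_def exchange_poly_not_var_dvd)
  have "s \<notin> vars P" using assms(2) by (simp add: P_def exchange_poly_notin_vars)
  have "P \<noteq> 0" using P_dvd[of s] by auto
  have "p \<noteq> 0" "X \<noteq> 0" using \<open>P \<noteq> 0\<close> by (simp_all add: p_def X_def)
  have Q_nz: "Q \<delta> \<noteq> 0" for \<delta> by (simp add: Q_def)
  have y: "y i = (if i = t then p / X else rat_var (\<sigma> i))" for i
    by (simp add: y_def cluster_map_def p_def P_def X_def t_def)
  have y_nz: "y i \<noteq> 0" for i using \<open>p \<noteq> 0\<close> \<open>X \<noteq> 0\<close> by (simp add: y)
  have g: "poly_subst (f t i) (\<lambda>j. rat_var (\<sigma> j)) = to_fract (g i)" for i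
    by (simp add: g_def to_fract_mpoly_eval rat_var_def)
  have s_g: "s \<notin> vars (g i)" if "i \<le> \<eta> t" for i
  proof
    assume "s \<in> vars (g i)"
    then obtain j where j: "j \<in> vars (f t i)" "s \<in> vars (var (\<sigma> j))"
      unfolding g_def using subsetD[OF vars_mpoly_eval] by (metis UN_E)
    from j(2) have "\<sigma> j = s" using vars_var_power[of "\<sigma> j" 1] by auto
    then have "j = t" using inv_\<sigma>[of j] by (simp add: t_def)
    then show False using assms(5)[OF that] j(1) by simp
  qed
  \<comment> \<open>Renaming \<open>g i\<close> along \<open>inv \<sigma>\<close> recovers
    \<open>f t i\<close>.\<close>
  have g_nz: "g i \<noteq> 0" if "f t i \<noteq> 0" for i
  proof
    assume "g i = 0"
    have "(\<lambda>j. mpoly_eval (Poly_Mapping.single 0) (\<lambda>j. var (inv \<sigma> j)) (var (\<sigma> j))) = var"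
      by (simp add: const_hom.mpoly_eval_var inv_\<sigma>)
    then have "mpoly_eval (Poly_Mapping.single 0) (\<lambda>j. var (inv \<sigma> j)) (g i) = f t i"
      by (simp add: g_def mpoly_subst_hom.hom_mpoly_eval comp_def const_hom.mpoly_eval_single
          mpoly_eval_vars)
    with that \<open>g i = 0\<close> show False by (simp add: mpoly_subst_hom.hom_zero)
  qed

  \<comment> \<open>Expansion of both sides in powers of \<open>x\<^sub>s\<close>\<close>
  have lhs: "laurent_subst F y =
    (\<Sum>i=0..\<eta> t. to_fract (g i) * p powi (int i - d t) * X powi (d t - int i)) / Q (d \<circ> inv \<sigma>)"
  proof -
    have "poly_subst T y = (\<Sum>i=0..\<eta> t. poly_subst (f t i) y * y t ^ i)"
      by (subst T_eq[of t])
        (simp add: poly_subst_hom.hom_sum poly_subst_hom.hom_mult poly_subst_hom.hom_power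
          poly_subst_var)
    also have "\<dots> = (\<Sum>i=0..\<eta> t. to_fract (g i) * (p / X) ^ i)"
    proof (rule sum.cong)
      fix i assume "i \<in> {0..\<eta> t}"
      \<comment> \<open>The cluster map differs from the permutation of variables only in component
        \<open>t\<close>, which \<open>f t i\<close> does not see.\<close>
      then have "t \<notin> vars (f t i)" using assms(5) by simp
      then have "poly_subst (f t i) y = poly_subst (f t i) (\<lambda>j. rat_var (\<sigma> j))"
        unfolding poly_subst_eq_mpoly_eval by (intro mpoly_eval_cong) (auto simp: y)
      then show "poly_subst (f t i) y * y t ^ i = to_fract (g i) * (p / X) ^ i"
        by (simp add: g y)
    qed simp
    finally have 1: "poly_subst T y = (\<Sum>i=0..\<eta> t. to_fract (g i) * (p / X) ^ i)" .
    have "(\<Prod>i\<in>UNIV. y i powi d i) = y t powi d t * (\<Prod>i\<in>-{t}. y i powi d i)"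
      by (subst prod.remove[of _ t]) (simp_all add: Compl_eq_Diff_UNIV)
    \<comment> \<open>The substitution \<open>j = \<sigma> i\<close> maps the indices other than
      \<open>t\<close> onto those other than \<open>s\<close>.\<close>
    also have "(\<Prod>i\<in>-{t}. y i powi d i) = Q (d \<circ> inv \<sigma>)"
      unfolding Q_def
      by (rule prod.reindex_bij_witness[of _ "inv \<sigma>" \<sigma>]) 
        (auto simp: y inv_\<sigma> \<sigma>_inv \<sigma>t inv_eq_t \<sigma>_eq_s)
    finally have 2: "(\<Prod>i\<in>UNIV. y i powi d i) = (p / X) powi d t * Q (d \<circ> inv \<sigma>)"
      by (simp add: y)
    have 3: "to_fract (g i) * (p / X) ^ i / (p / X) powi d t =
        to_fract (g i) * p powi (int i - d t) * X powi (d t - int i)" for i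
      using \<open>p \<noteq> 0\<close> \<open>X \<noteq> 0\<close>
      by (simp add: power_int_diff power_int_divide_distrib power_divide)
    show ?thesis
      unfolding laurent_subst_quotient[OF T y_nz] 1 2 divide_divide_eq_left[symmetric]
        sum_divide_distrib 3 ..
  qed
  have rhs: "laurent_subst F rat_var =
    (\<Sum>i=0..\<eta> s. to_fract (f s i) * X powi (int i - d s)) / Q d"
  proof -
    have "rat_monom d = X powi d s * Q d"
      unfolding rat_monom_def Q_def X_def
      by (subst prod.remove[of _ s]) (simp_all add: Compl_eq_Diff_UNIV)
    moreover have "to_fract (f s i * var s ^ i) / X powi d s =
        to_fract (f s i) * X powi (int i - d s)" for i
      using \<open>X \<noteq> 0\<close>
      by (simp add: power_int_diff fract_hom.hom_power X_def rat_var_def)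
    ultimately show ?thesis
      unfolding assms(4)[of s]
      by (simp add: sum_divide_distrib flip: divide_divide_eq_left to_fract_mult)
  qed

  show ?thesis
    unfolding t_def[symmetric] g y_def[symmetric] P_def[symmetric] p_def[symmetric]
  proof

    \<comment> \<open>Sufficiency of the three relations\<close>
    assume "(\<forall>i\<in>{0..\<eta> s}. to_fract (g i) = to_fract (f s (\<eta> s - i)) * p powi (d s - int i)) \<and>
      (\<forall>i. d i = d (\<sigma> i)) \<and> \<eta> s = \<eta> t \<and> int (\<eta> t) = 2 * d s \<and> 2 * d s = 2 * d t"
    then have rel: "\<And>i. i \<le> \<eta> s \<Longrightarrow>
        to_fract (g i) = to_fract (f s (\<eta> s - i)) * p powi (d s - int i)"
      and d\<sigma>: "\<And>i. d (\<sigma> i) = d i" and \<eta>t: "\<eta> t = \<eta> s" "int (\<eta> s) = 2 * d s" "d t = d s"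
      by auto
    have "d \<circ> inv \<sigma> = d" using d\<sigma>[of "inv \<sigma> _"] by (auto simp: \<sigma>_inv)
    \<comment> \<open>Index \<open>i\<close> on the left is matched with \<open>\<eta> s - i\<close>
      on the right: the powers of \<open>P\<close> cancel by \<open>rel\<close>, and those of
      \<open>x\<^sub>s\<close> agree because \<open>\<eta> s = 2 * d s\<close>.\<close>
    moreover have "(\<Sum>i=0..\<eta> t. to_fract (g i) * p powi (int i - d t) * X powi (d t - int i)) =
      (\<Sum>i=0..\<eta> s. to_fract (f s (\<eta> s - i)) * X powi (int (\<eta> s - i) - d s))"
    proof (rule sum.cong)
      fix i assume i: "i \<in> {0..\<eta> s}"
      then have "int (\<eta> s - i) - d s = d s - int i" using \<eta>t by auto
      moreover have "p powi (d s - int i) * p powi (int i - d s) = 1"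
        using \<open>p \<noteq> 0\<close> by (simp flip: power_int_add)
      ultimately show "to_fract (g i) * p powi (int i - d t) * X powi (d t - int i) =
        to_fract (f s (\<eta> s - i)) * X powi (int (\<eta> s - i) - d s)"
        using i by (simp add: rel \<eta>t mult.assoc)
    qed (simp add: \<eta>t)
    moreover have "\<dots> = (\<Sum>i=0..\<eta> s. to_fract (f s i) * X powi (int i - d s))"
      by (subst (2) sum.atLeastAtMost_rev) simp
    ultimately show "laurent_subst F y = laurent_subst F rat_var"
      by (simp only: lhs rhs)
  next

    \<comment> \<open>Necessity of the three relations\<close>
    assume eq: "laurent_subst F y = laurent_subst F rat_var"
    \<comment> \<open>Multiplying by the \<open>N\<close>-th power of \<open>P x\<^sub>1 \<cdots> x\<^sub>n\<close> clears all denominators.\<close>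
    define N where "N = (\<Sum>i\<in>UNIV. \<bar>d i\<bar>) + int (\<eta> s) + int (\<eta> t)"
    \<comment> \<open>The slack from \<open>\<eta>\<close> keeps exponents such as
      \<open>N + d t - int i\<close> nonnegative, so \<open>nat\<close> does not truncate
      them.\<close>
    have dN: "\<bar>d i\<bar> + int (\<eta> s) + int (\<eta> t) \<le> N" for i
      unfolding N_def using member_le_sum[of i UNIV "\<lambda>i. \<bar>d i\<bar>"] by simp
    define M :: "('n \<Rightarrow> int) \<Rightarrow> 'n mpoly"
      where "M \<delta> = (\<Prod>j\<in>-{s}. var j ^ nat (N - \<delta> j))" for \<delta>
    have M: "to_fract (M \<delta>) = Q (\<lambda>_. N) / Q \<delta>" if "\<And>j. \<delta> j \<le> N" for \<delta>
    proof -
      have "rat_var j ^ nat (N - \<delta> j) = rat_var j powi N / rat_var j powi \<delta> j" for j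
        using that[of j] by (simp add: power_int_nonneg_exp flip: power_int_diff)
      then show ?thesis
        by (simp add: M_def Q_def fract_hom.hom_prod fract_hom.hom_power flip: rat_var_def prod_dividef)
    qed
    have M_nz: "M \<delta> \<noteq> 0" for \<delta> by (simp add: M_def)
    have s_M: "s \<notin> vars (M \<delta>)" for \<delta>
    proof
      assume "s \<in> vars (M \<delta>)"
      then obtain j where "j \<noteq> s" "s \<in> vars (var j ^ nat (N - \<delta> j))"
        unfolding M_def using vars_prod by fastforce
      with vars_var_power[of j "nat (N - \<delta> j)"] show False by (auto split: if_splits)
    qed
    \<comment> \<open>After clearing denominators, \<open>a i\<close> is the coefficient that
      accompanies \<open>x\<^sub>s\<close> to the power \<open>e i\<close> in
      \<open>F(\<psi>(x))\<close>; \<open>b i\<close> and \<open>e' i\<close> do the same for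
      \<open>F(x)\<close>.\<close>
    define a where "a i = M (d \<circ> inv \<sigma>) * (g i * P ^ nat (N + int i - d t))" for i
    define b where "b i = M d * (P ^ nat N * f s i)" for i
    define e where "e i = nat (N + d t - int i)" for i
    define e' where "e' i = nat (N + int i - d s)" for i
    have a_nz: "a i \<noteq> 0" if "f t i \<noteq> 0" for i
      using g_nz[OF that] M_nz \<open>P \<noteq> 0\<close> by (simp add: a_def)
    have b_nz: "b i \<noteq> 0" if "f s i \<noteq> 0" for i
      using that M_nz \<open>P \<noteq> 0\<close> by (simp add: b_def)
    have s_a: "s \<notin> vars (a i)" if "i \<in> {0..\<eta> t}" for i
      using that s_M s_g[of i] \<open>s \<notin> vars P\<close>
      by (auto simp: a_def dest!: subsetD[OF vars_mult] subsetD[OF vars_power])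
    have s_b: "s \<notin> vars (b i)" if "i \<in> {0..\<eta> s}" for i
      using that s_M assms(5)[of i s] \<open>s \<notin> vars P\<close>
      by (auto simp: b_def dest!: subsetD[OF vars_mult] subsetD[OF vars_power])
    define E where "E = Q (\<lambda>_. N) * p powi N * X powi N"
    have "to_fract (\<Sum>i=0..\<eta> t. a i * var s ^ e i) = E * laurent_subst F y"
      unfolding lhs to_fract_sum sum_divide_distrib sum_distrib_left
    proof (rule sum.cong)
      fix i assume i: "i \<in> {0..\<eta> t}"
      have 1: "p ^ nat (N + int i - d t) = p powi N * p powi (int i - d t)"
        using dN[of t] \<open>p \<noteq> 0\<close> by (intro power_nat_eq_powi_mult) simp_all
      have 2: "X ^ nat (N + d t - int i) = X powi N * X powi (d t - int i)"
        using dN[of t] i \<open>X \<noteq> 0\<close> by (intro power_nat_eq_powi_mult) simp_all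
      have 3: "to_fract (M (d \<circ> inv \<sigma>)) = Q (\<lambda>_. N) / Q (d \<circ> inv \<sigma>)"
        using dN by (intro M) (smt (verit) comp_apply of_nat_0_le_iff)
      have "to_fract (a i * var s ^ e i) = to_fract (M (d \<circ> inv \<sigma>)) *
          (to_fract (g i) * p ^ nat (N + int i - d t)) * X ^ nat (N + d t - int i)"
        by (simp add: a_def e_def fract_hom.hom_power p_def X_def rat_var_def)
      then show "to_fract (a i * var s ^ e i) = E * (to_fract (g i) * p powi (int i - d t) *
          X powi (d t - int i) / Q (d \<circ> inv \<sigma>))"
        by (simp add: 1 2 3 E_def)
    qed simp
    also have "\<dots> = to_fract (\<Sum>i=0..\<eta> s. b i * var s ^ e' i)"
      unfolding eq rhs to_fract_sum sum_divide_distrib sum_distrib_left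
    proof (rule sum.cong)
      fix i assume i: "i \<in> {0..\<eta> s}"
      have 1: "p ^ nat N = p powi N"
        using dN[of t] by (simp add: power_int_nonneg_exp)
      have 2: "X ^ nat (N + int i - d s) = X powi N * X powi (int i - d s)"
        using dN[of s] \<open>X \<noteq> 0\<close> by (intro power_nat_eq_powi_mult) simp_all
      have 3: "to_fract (M d) = Q (\<lambda>_. N) / Q d"
        using dN by (intro M) (smt (verit) of_nat_0_le_iff)
      have "to_fract (b i * var s ^ e' i) = to_fract (M d) *
          (p ^ nat N * to_fract (f s i)) * X ^ nat (N + int i - d s)"
        by (simp add: b_def e'_def fract_hom.hom_power p_def X_def rat_var_def)
      then show "E * (to_fract (f s i) * X powi (int i - d s) / Q d) =
          to_fract (b i * var s ^ e' i)"
        by (simp add: 1 2 3 E_def)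
    qed simp
    finally have "(\<Sum>i=0..\<eta> t. a i * var s ^ e i) = (\<Sum>i=0..\<eta> s. b i * var s ^ e' i)"
      by (simp only: to_fract_eq_iff)
    then have coeffs: "(\<Sum>i=0..\<eta> t. if e i = k then a i else 0) =
        (\<Sum>i=0..\<eta> s. if e' i = k then b i else 0)" for k
      using coeff_expand_in_sum[where I = "{0..\<eta> t}" and a = a and e = e, OF s_a, of k]
        coeff_expand_in_sum[where I = "{0..\<eta> s}" and a = b and e = e', OF s_b, of k]
      by simp
    \<comment> \<open>Distinct indices give distinct exponents, so each sum in \<open>coeffs\<close>
      has at most one nonzero term.\<close>
    have e_inj: "e i = e j \<longleftrightarrow> i = j" if "i \<le> \<eta> t" "j \<le> \<eta> t" for i j
      using that dN[of t] by (auto simp: e_def)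
    have e'_inj: "e' i = e' j \<longleftrightarrow> i = j" if "i \<le> \<eta> s" "j \<le> \<eta> s" for i j
      using that dN[of s] by (auto simp: e'_def)
    have sum_a: "(\<Sum>j=0..\<eta> t. if e j = e i then a j else 0) = a i" if "i \<le> \<eta> t" for i
      using that by (subst sum.cong[OF refl, of _ _ "\<lambda>j. if j = i then a j else 0"])
        (simp_all add: e_inj)
    have sum_b: "(\<Sum>j=0..\<eta> s. if e' j = e' i then b j else 0) = b i" if "i \<le> \<eta> s" for i
      using that by (subst sum.cong[OF refl, of _ _ "\<lambda>j. if j = i then b j else 0"])
        (simp_all add: e'_inj)
    have a_eq_b: "a i = b j" if "i \<le> \<eta> t" "j \<le> \<eta> s" "e i = e' j" for i j
      using coeffs[of "e i"] sum_a[OF that(1)] sum_b[OF that(2)] that(3) by simp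
    \<comment> \<open>A nonzero \<open>a i\<close> needs a partner \<open>b j\<close> with
      \<open>e i = e' j\<close>, and this equation says \<open>i + j = d s + d t\<close>.\<close>
    have exp_a: "\<exists>j\<le>\<eta> s. int j = d s + d t - int i" if i: "i \<le> \<eta> t" "f t i \<noteq> 0" for i
    proof -
      have "(\<Sum>j=0..\<eta> s. if e' j = e i then b j else 0) \<noteq> 0"
        using coeffs[of "e i"] sum_a[OF i(1)] a_nz[OF i(2)] by simp
      then obtain j where "j \<in> {0..\<eta> s}" "(if e' j = e i then b j else 0) \<noteq> 0"
        by (rule sum.not_neutral_contains_not_neutral)
      then have "j \<le> \<eta> s" "e' j = e i" by (simp_all split: if_splits)
      then have "int j = d s + d t - int i"
        using i(1) dN[of s] dN[of t] by (simp add: e_def e'_def)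
      with \<open>j \<le> \<eta> s\<close> show ?thesis by blast
    qed
    have exp_b: "\<exists>j\<le>\<eta> t. int j = d s + d t - int i" if i: "i \<le> \<eta> s" "f s i \<noteq> 0" for i
    proof -
      have "(\<Sum>j=0..\<eta> t. if e j = e' i then a j else 0) \<noteq> 0"
        using coeffs[of "e' i"] sum_b[OF i(1)] b_nz[OF i(2)] by simp
      then obtain j where "j \<in> {0..\<eta> t}" "(if e j = e' i then a j else 0) \<noteq> 0"
        by (rule sum.not_neutral_contains_not_neutral)
      then have "j \<le> \<eta> t" "e j = e' i" by (simp_all split: if_splits)
      then have "int j = d s + d t - int i"
        using i(1) dN[of s] dN[of t] by (simp add: e_def e'_def)
      with \<open>j \<le> \<eta> t\<close> show ?thesis by blast
    qed
    \<comment> \<open>The partners of the indices 0 show that \<open>d s + d t\<close> is at most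
      \<open>\<eta> s\<close> and \<open>\<eta> t\<close>; those of the last indices give the
      reverse bounds.\<close>
    have \<eta>_eq: "\<eta> t = \<eta> s" "int (\<eta> s) = d s + d t"
      using exp_a[OF _ f_0] exp_a[OF _ f_last] exp_b[OF _ f_0] exp_b[OF _ f_last] by force+
    have rel: "a i = b (\<eta> s - i)" if "i \<le> \<eta> s" for i
      using that \<eta>_eq dN[of s] dN[of t]
      by (intro a_eq_b) (auto simp: e_def e'_def)

    \<comment> \<open>If the exponents of \<open>x\<^sub>j\<close> differed, then \<open>x\<^sub>j\<close> would divide all coefficients on the side
      with the smaller exponent, hence a variable would divide \<open>T\<close>.\<close>
    have "d (inv \<sigma> j) = d j" if "j \<noteq> s" for j
    proof -
      define M' :: "('n \<Rightarrow> int) \<Rightarrow> 'n mpoly"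
        where "M' \<delta> = (\<Prod>k\<in>-{s}-{j}. var k ^ nat (N - \<delta> k))" for \<delta>
      have M_split: "M \<delta> = var j ^ nat (N - \<delta> j) * M' \<delta>" for \<delta>
        unfolding M_def M'_def using that by (subst prod.remove[of _ j]) auto
      have M'_dvd: "\<not> var j dvd M' \<delta>" for \<delta>
        by (auto simp: M'_def var_dvd_prod_iff var_dvd_power_iff var_dvd_var_iff)
      have rel': "var j ^ nat (N - d (inv \<sigma> j)) *
          (M' (d \<circ> inv \<sigma>) * (g i * P ^ nat (N + int i - d t))) =
        var j ^ nat (N - d j) * (M' d * (P ^ nat N * f s (\<eta> s - i)))" if "i \<le> \<eta> s" for i
        using rel[OF that] by (simp add: a_def b_def M_split mult.assoc)
      have "\<not> d (inv \<sigma> j) < d j"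
      proof
        assume "d (inv \<sigma> j) < d j"
        then have less: "nat (N - d j) < nat (N - d (inv \<sigma> j))"
          using dN[of j] by simp
        have "var j dvd f s i" if "i \<le> \<eta> s" for i
          using var_dvd_if_power_less[OF rel'[of "\<eta> s - i"] less] that P_dvd M'_dvd
          by (simp add: var_dvd_mult_iff var_dvd_power_iff)
        then have "var j dvd T" by (subst T_eq[of s]) (intro dvd_sum, simp)
        with T_dvd show False by blast
      qed
      moreover have "\<not> d j < d (inv \<sigma> j)"
      proof
        assume "d j < d (inv \<sigma> j)"
        then have less: "nat (N - d (inv \<sigma> j)) < nat (N - d j)"
          using dN[of "inv \<sigma> j"] by simp
        \<comment> \<open>On this side the divisibility concerns the renamed coefficient
          \<open>g i\<close>, so the variable is renamed back before \<open>T\<close> is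
          reached.\<close>
        have "var (inv \<sigma> j) dvd f t i" if "i \<le> \<eta> t" for i
        proof -
          have "var j dvd g i"
            using var_dvd_if_power_less[OF rel'[of i, symmetric] less] that P_dvd M'_dvd \<eta>_eq(1)
            by (simp add: var_dvd_mult_iff var_dvd_power_iff)
          then have "var (\<sigma> (inv \<sigma> j)) dvd g i" by (simp only: \<sigma>_inv)
          with assms(1) show ?thesis unfolding g_def by (rule var_dvd_if_var_dvd_rename)
        qed
        then have "var (inv \<sigma> j) dvd T" by (subst T_eq[of t]) (intro dvd_sum, simp)
        with T_dvd show False by blast
      qed
      ultimately show ?thesis by simp
    qed
    note d_inv = this
    \<comment> \<open>The remaining equality \<open>d\<^sub>t = d\<^sub>s\<close> holds because a permutation preserves the sum of \<open>d\<close>.\<close>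
    have "(\<Sum>j\<in>UNIV. d (inv \<sigma> j)) = (\<Sum>j\<in>UNIV. d j)"
      by (rule sum.reindex_bij_betw) (simp add: assms(1) bij_imp_bij_inv)
    then have "d t + (\<Sum>j\<in>-{s}. d (inv \<sigma> j)) = d s + (\<Sum>j\<in>-{s}. d j)"
      by (simp add: sum.remove[of UNIV s] t_def Compl_eq_Diff_UNIV)
    then have dt: "d t = d s" by (simp add: d_inv)
    have d_inv': "d (inv \<sigma> j) = d j" for j
      using d_inv[of j] dt by (cases "j = s") (simp_all add: t_def)
    have "to_fract (g i) = to_fract (f s (\<eta> s - i)) * p powi (d s - int i)" if "i \<le> \<eta> s" for i
    proof -
      \<comment> \<open>Now both sides of \<open>rel\<close> carry the same monomial factor
        \<open>M d\<close>, which cancels and leaves only powers of \<open>P\<close>.\<close>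
      have "d \<circ> inv \<sigma> = d" by (simp add: fun_eq_iff d_inv')
      then have "g i * P ^ nat (N + int i - d t) = P ^ nat N * f s (\<eta> s - i)"
        using rel[OF that] M_nz by (simp add: a_def b_def)
      then have "to_fract (g i * P ^ nat (N + int i - d t)) = to_fract (P ^ nat N * f s (\<eta> s - i))"
        by simp
      then have "to_fract (g i) * p ^ nat (N + int i - d t) = p ^ nat N * to_fract (f s (\<eta> s - i))"
        by (simp add: fract_hom.hom_power p_def)
      moreover have "p ^ nat (N + int i - d t) = p powi (N + int i - d t)" "p ^ nat N = p powi N"
        using dN[of t] by (simp_all add: power_int_nonneg_exp)
      \<comment> \<open>The exponents add up to \<open>N\<close> because \<open>d t = d s\<close>;
        cancelling the first factor leaves the required power of \<open>P\<close>.\<close>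
      moreover have "p powi N = p powi (N + int i - d t) * p powi (d s - int i)"
        using \<open>p \<noteq> 0\<close> by (simp add: dt flip: power_int_add)
      ultimately have "p powi (N + int i - d t) * to_fract (g i) =
          p powi (N + int i - d t) * (to_fract (f s (\<eta> s - i)) * p powi (d s - int i))"
        by (simp add: mult_ac)
      then show ?thesis using \<open>p \<noteq> 0\<close> by simp
    qed
    moreover have "d i = d (\<sigma> i)" for i using d_inv'[of "\<sigma> i"] by (simp add: inv_\<sigma>)
    ultimately show "(\<forall>i\<in>{0..\<eta> s}. to_fract (g i) = to_fract (f s (\<eta> s - i)) * p powi (d s - int i)) \<and>
      (\<forall>i. d i = d (\<sigma> i)) \<and> \<eta> s = \<eta> t \<and> int (\<eta> t) = 2 * d s \<and> 2 * d s = 2 * d t"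
      using \<eta>_eq dt by auto
  qed
qed

end
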